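(* Let $R\subseteq\mathbb{R}^2$ be a simply-connected region, let $M,N:R\to\mathbb{R}$ have continuous first-order partial derivatives in $R$, and suppose that the differential equation $$M(x,y)\,\mathrm{d}x+N(x,y)\,\mathrm{d}y=0$$ is exact in $R$. Then this equation admits a harmonic solution if and only if $$M_x+N_y=0 \quad\text{in } R.$$
   Context: Subscripts denote partial derivatives. A region is a nonempty connected open subset of the $xy$-plane. The equation $M\,\mathrm{d}x+N\,\mathrm{d}y=0$ is exact in $R$ if there is a function $f:R\to\mathbb{R}$ with $f_x=M$ and $f_y=N$ in $R$ (for a simply-connected region this is equivalent to $M_y=N_x$ in $R$). A solution of the exact equation means such a function $f$ (the integral curves being given by $f(x,y)=c$). A real-valued function $f$ is harmonic in $R$ if it has continuous first- and second-order partial derivatives in $R$ and $f_{xx}+f_{yy}=0$ there; the equation admits a harmonic solution if there is a function $f:R\to\mathbb{R}$ with $f_x=M$ and $f_y=N$ in $R$ that is harmonic in $R$. *)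

theory Defs
  imports "HOL-Analysis.Analysis"
begin

(* A function on a subset R of the plane is represented by a total function on real \<times> real.
   All definitions below are used only on open R, so that the partial derivatives at points of R
   depend only on the values of the function on R. *)

definition region :: "(real \<times> real) set \<Rightarrow> bool" where
  "region R \<longleftrightarrow> R \<noteq> {} \<and> open R \<and> connected R"

definition has_partial_x :: "(real \<times> real \<Rightarrow> real) \<Rightarrow> real \<Rightarrow> real \<times> real \<Rightarrow> bool" where
  "has_partial_x f D p \<longleftrightarrow> ((\<lambda>x. f (x, snd p)) has_real_derivative D) (at (fst p))"

definition has_partial_y :: "(real \<times> real \<Rightarrow> real) \<Rightarrow> real \<Rightarrow> real \<times> real \<Rightarrow> bool" where
  "has_partial_y f D p \<longleftrightarrow> ((\<lambda>y. f (fst p, y)) has_real_derivative D) (at (snd p))"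

(* The values of partial_x and partial_y are meaningful only where the derivatives exist. *)

definition partial_x :: "(real \<times> real \<Rightarrow> real) \<Rightarrow> real \<times> real \<Rightarrow> real" where
  "partial_x f p = deriv (\<lambda>x. f (x, snd p)) (fst p)"

definition partial_y :: "(real \<times> real \<Rightarrow> real) \<Rightarrow> real \<times> real \<Rightarrow> real" where
  "partial_y f p = deriv (\<lambda>y. f (fst p, y)) (snd p)"

definition C1_partials_on :: "(real \<times> real) set \<Rightarrow> (real \<times> real \<Rightarrow> real) \<Rightarrow> bool" where
  "C1_partials_on R f \<longleftrightarrow>
     (\<forall>p\<in>R. (\<exists>D. has_partial_x f D p) \<and> (\<exists>D. has_partial_y f D p)) \<and>
     continuous_on R (partial_x f) \<and> continuous_on R (partial_y f)"

definition C2_partials_on :: "(real \<times> real) set \<Rightarrow> (real \<times> real \<Rightarrow> real) \<Rightarrow> bool" where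
  "C2_partials_on R f \<longleftrightarrow>
     C1_partials_on R f \<and> C1_partials_on R (partial_x f) \<and> C1_partials_on R (partial_y f)"

definition harmonic_in :: "(real \<times> real) set \<Rightarrow> (real \<times> real \<Rightarrow> real) \<Rightarrow> bool" where
  "harmonic_in R f \<longleftrightarrow>
     C2_partials_on R f \<and>
     (\<forall>p\<in>R. partial_x (partial_x f) p + partial_y (partial_y f) p = 0)"

definition solution_of ::
  "(real \<times> real) set \<Rightarrow> (real \<times> real \<Rightarrow> real) \<Rightarrow> (real \<times> real \<Rightarrow> real) \<Rightarrow> (real \<times> real \<Rightarrow> real) \<Rightarrow> bool" where
  "solution_of R M N f \<longleftrightarrow> (\<forall>p\<in>R. has_partial_x f (M p) p \<and> has_partial_y f (N p) p)"

definition exact_in ::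
  "(real \<times> real) set \<Rightarrow> (real \<times> real \<Rightarrow> real) \<Rightarrow> (real \<times> real \<Rightarrow> real) \<Rightarrow> bool" where
  "exact_in R M N \<longleftrightarrow> (\<exists>f. solution_of R M N f)"

definition admits_harmonic_solution ::
  "(real \<times> real) set \<Rightarrow> (real \<times> real \<Rightarrow> real) \<Rightarrow> (real \<times> real \<Rightarrow> real) \<Rightarrow> bool" where
  "admits_harmonic_solution R M N \<longleftrightarrow> (\<exists>f. solution_of R M N f \<and> harmonic_in R f)"

end

theory Submission
  imports Defs
begin

text \<open>Any solution \<open>f\<close> has \<open>f\<^sub>x = M\<close> and \<open>f\<^sub>y = N\<close> throughout the open set \<open>R\<close>, so the second partial
  derivatives of \<open>f\<close> are first partial derivatives of \<open>M\<close> and \<open>N\<close>, and the Laplacian of \<open>f\<close> is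
  \<open>M\<^sub>x + N\<^sub>y\<close>. Hence \<open>f\<close> satisfies Laplace's equation exactly when \<open>M\<^sub>x + N\<^sub>y = 0\<close>. Substituting \<open>M\<close>
  for \<open>f\<^sub>x\<close> under a further derivative is legitimate because partial derivatives at a point of an
  open set only see the values on that set (lemmas \<open>partial_x_cong\<close> and \<open>partial_y_cong\<close>).

  The one analytic point is that every solution has the smoothness that harmonicity demands: its
  second partial derivatives are continuous by hypothesis on \<open>M\<close> and \<open>N\<close>, but continuity of its first
  partial derivatives means that \<open>M\<close> and \<open>N\<close> themselves are continuous. Existence of partial
  derivatives alone does not give this; their continuity does, since it makes the function totally
  differentiable (lemma \<open>C1_partials_on_imp_continuous_on\<close>).

  Thus, for a given solution, harmonicity is equivalent to \<open>M\<^sub>x + N\<^sub>y = 0\<close>, and exactness supplies a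
  solution.\<close>

lemma has_partial_x_cong:
  assumes "open R" "p \<in> R" and eq: "\<And>q. q \<in> R \<Longrightarrow> f q = g q"
  shows "has_partial_x f D p \<longleftrightarrow> has_partial_x g D p"
proof -
  have "open ((\<lambda>x. (x, snd p)) -` R)"
    by (intro open_vimage assms continuous_intros)
  then have "eventually (\<lambda>x. x \<in> (\<lambda>x. (x, snd p)) -` R) (nhds (fst p))"
    using \<open>p \<in> R\<close> by (intro eventually_nhds_in_open) auto
  then have "eventually (\<lambda>x. f (x, snd p) = g (x, snd p)) (nhds (fst p))"
    by eventually_elim (simp add: eq)
  then show ?thesis
    unfolding has_partial_x_def by (intro DERIV_cong_ev) auto
qed

lemma has_partial_y_cong:
  assumes "open R" "p \<in> R" and eq: "\<And>q. q \<in> R \<Longrightarrow> f q = g q"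
  shows "has_partial_y f D p \<longleftrightarrow> has_partial_y g D p"
proof -
  have "open ((\<lambda>y. (fst p, y)) -` R)"
    by (intro open_vimage assms continuous_intros)
  then have "eventually (\<lambda>y. y \<in> (\<lambda>y. (fst p, y)) -` R) (nhds (snd p))"
    using \<open>p \<in> R\<close> by (intro eventually_nhds_in_open) auto
  then have "eventually (\<lambda>y. f (fst p, y) = g (fst p, y)) (nhds (snd p))"
    by eventually_elim (simp add: eq)
  then show ?thesis
    unfolding has_partial_y_def by (intro DERIV_cong_ev) auto
qed

lemma partial_x_cong:
  assumes "open R" "p \<in> R" "\<And>q. q \<in> R \<Longrightarrow> f q = g q"
  shows "partial_x f p = partial_x g p"
  using has_partial_x_cong[of R p f g] assms
  unfolding partial_x_def deriv_def has_partial_x_def by simp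

lemma partial_y_cong:
  assumes "open R" "p \<in> R" "\<And>q. q \<in> R \<Longrightarrow> f q = g q"
  shows "partial_y f p = partial_y g p"
  using has_partial_y_cong[of R p f g] assms
  unfolding partial_y_def deriv_def has_partial_y_def by simp

lemma C1_partials_on_cong:
  assumes "open R" "\<And>q. q \<in> R \<Longrightarrow> f q = g q"
  shows "C1_partials_on R f \<longleftrightarrow> C1_partials_on R g"
proof -
  have "continuous_on R (partial_x f) \<longleftrightarrow> continuous_on R (partial_x g)"
    "continuous_on R (partial_y f) \<longleftrightarrow> continuous_on R (partial_y g)"
    using partial_x_cong[OF assms(1) _ assms(2)] partial_y_cong[OF assms(1) _ assms(2)]
    by (auto intro!: continuous_on_cong)
  then show ?thesis
    using has_partial_x_cong[OF assms(1) _ assms(2)] has_partial_y_cong[OF assms(1) _ assms(2)]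
    unfolding C1_partials_on_def by simp
qed

lemma has_partial_x_imp_partial_x: "has_partial_x f D p \<Longrightarrow> partial_x f p = D"
  unfolding has_partial_x_def partial_x_def by (rule DERIV_imp_deriv)

lemma has_partial_y_imp_partial_y: "has_partial_y f D p \<Longrightarrow> partial_y f p = D"
  unfolding has_partial_y_def partial_y_def by (rule DERIV_imp_deriv)

text \<open>Near each point, \<open>R\<close> contains a product of an open set and a ball. On such a product, the mean
  value argument in the second variable, combined with the partial derivative in the first variable,
  yields the total derivative, and a totally differentiable function is continuous.\<close>

lemma C1_partials_on_imp_continuous_on:
  assumes "open R" and C1: "C1_partials_on R f"
  shows "continuous_on R f"
proof -
  have dx: "((\<lambda>x. f (x, y)) has_real_derivative partial_x f (x, y)) (at x)"
    and dy: "((\<lambda>y. f (x, y)) has_real_derivative partial_y f (x, y)) (at y)"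
    if "(x, y) \<in> R" for x y
    using C1 that has_partial_x_imp_partial_x[of f _ "(x, y)"]
      has_partial_y_imp_partial_y[of f _ "(x, y)"]
    unfolding C1_partials_on_def has_partial_x_def has_partial_y_def by force+
  have "isCont f (a, b)" if p: "(a, b) \<in> R" for a b
  proof -
    obtain X Y' where "open X" "open Y'" "(a, b) \<in> X \<times> Y'" "X \<times> Y' \<subseteq> R"
      using open_prod_elim[OF \<open>open R\<close> p] by metis
    moreover from this obtain e where "e > 0" "ball b e \<subseteq> Y'"
      using open_contains_ball by (metis mem_Sigma_iff)
    moreover define Y where "Y = ball b e"
    ultimately have box: "open X" "open Y" "convex Y" "a \<in> X" "b \<in> Y" "X \<times> Y \<subseteq> R"
      by auto
    define F where "F = (\<lambda>x y. blinfun_scaleR_left (partial_y f (x, y)))"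
    have "continuous (at (a, b)) (partial_y f)"
      using C1 p \<open>open R\<close> unfolding C1_partials_on_def
      by (simp add: continuous_on_eq_continuous_at)
    then have F_cont: "continuous (at (a, b) within X \<times> Y) (\<lambda>(x, y). F x y)"
      unfolding F_def case_prod_unfold continuous_at
      by (auto simp: continuous_within intro!: tendsto_intros intro: tendsto_within_subset)
    have "((\<lambda>(x, y). f (x, y)) has_derivative
        (\<lambda>(tx, ty). partial_x f (a, b) * tx + blinfun_apply (F a b) ty)) (at (a, b) within X \<times> Y)"
    proof (rule has_derivative_partialsI[OF _ _ F_cont \<open>b \<in> Y\<close> \<open>convex Y\<close>])
      show "((\<lambda>x. f (x, b)) has_derivative (*) (partial_x f (a, b))) (at a within X)"
        using dx[OF p] unfolding has_field_derivative_def by (rule has_derivative_at_withinI)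
    next
      fix x y assume "x \<in> X" "y \<in> Y"
      then have "((\<lambda>y. f (x, y)) has_derivative (*) (partial_y f (x, y))) (at y within Y)"
        using dy box unfolding has_field_derivative_def by (blast intro: has_derivative_at_withinI)
      then show "((\<lambda>y. f (x, y)) has_derivative blinfun_apply (F x y)) (at y within Y)"
        unfolding F_def by (rule has_derivative_eq_rhs) (auto simp: mult.commute)
    qed
    then have "continuous (at (a, b) within X \<times> Y) f"
      by (auto simp: case_prod_unfold dest: has_derivative_continuous)
    then show ?thesis
      using box by (simp add: at_within_open[OF _ open_Times])
  qed
  then show ?thesis
    by (auto intro: continuous_at_imp_continuous_on)
qed

text \<open>Every solution already has the required regularity, and its Laplacian is \<open>M\<^sub>x + N\<^sub>y\<close>; so
  harmonicity does not depend on which solution is considered.\<close>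

lemma solution_harmonic_iff:
  assumes "open R" "C1_partials_on R M" "C1_partials_on R N" and sol: "solution_of R M N f"
  shows "harmonic_in R f \<longleftrightarrow> (\<forall>p\<in>R. partial_x M p + partial_y N p = 0)"
proof -
  have fx: "partial_x f p = M p" and fy: "partial_y f p = N p" if "p \<in> R" for p
    using sol that has_partial_x_imp_partial_x has_partial_y_imp_partial_y
    unfolding solution_of_def by blast+
  have "continuous_on R (partial_x f)" "continuous_on R (partial_y f)"
    using C1_partials_on_imp_continuous_on[OF assms(1,2)]
      C1_partials_on_imp_continuous_on[OF assms(1,3)]
    by (simp_all add: fx fy cong: continuous_on_cong)
  then have "C1_partials_on R f"
    using sol unfolding C1_partials_on_def solution_of_def by blast
  moreover have "C1_partials_on R (partial_x f)" "C1_partials_on R (partial_y f)"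
    using assms C1_partials_on_cong[OF \<open>open R\<close> fx] C1_partials_on_cong[OF \<open>open R\<close> fy] by simp_all
  ultimately have "C2_partials_on R f"
    unfolding C2_partials_on_def by simp
  moreover have "partial_x (partial_x f) p = partial_x M p" "partial_y (partial_y f) p = partial_y N p"
    if "p \<in> R" for p
    using partial_x_cong[OF \<open>open R\<close> that fx] partial_y_cong[OF \<open>open R\<close> that fy] by simp_all
  ultimately show ?thesis
    unfolding harmonic_in_def by simp
qed

theorem theorem2:
  fixes R :: "(real \<times> real) set" and M N :: "real \<times> real \<Rightarrow> real"
  assumes "region R" and "simply_connected R"
    and "C1_partials_on R M" and "C1_partials_on R N"
    and "exact_in R M N"
  shows "admits_harmonic_solution R M N \<longleftrightarrow> (\<forall>p\<in>R. partial_x M p + partial_y N p = 0)"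
proof -
  have "open R"
    using \<open>region R\<close> by (simp add: region_def)
  then show ?thesis
    using solution_harmonic_iff[OF _ assms(3,4)] \<open>exact_in R M N\<close>
    unfolding admits_harmonic_solution_def exact_in_def by blast
qed

end
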